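(* Let $W$ be the Weyl group of type $G_2$, with simple reflections $s,t$ and length function $\ell$. Let $\{P_w\mid w\in W\}$ be a set of homogeneous polynomials (with real coefficients) in the variables $x_1$ and $x_2$, with $\deg P_w=\ell(w)$. Suppose that for all $w\in W$ $$\partial_sP_w=\begin{cases}P_{ws}&\text{when }\ell(ws)<\ell(w),\\0&\text{when }\ell(ws)>\ell(w),\end{cases}\qquad \partial_tP_w=\begin{cases}P_{wt}&\text{when }\ell(wt)<\ell(w),\\0&\text{when }\ell(wt)>\ell(w).\end{cases}$$ Then for some $w$, $P_w$ has both positive and negative coefficients.
   Context: $W=\langle s,t\mid s^2=t^2=(st)^6=1\rangle$ is the dihedral group of order $12$, with length taken with respect to $\{s,t\}$. The divided difference operators are $$\partial_s(f)=\frac{f(x_1,x_2)-f(x_2,x_1)}{x_1-x_2},\qquad \partial_t(f)=\frac{f(x_1,x_2)-f(x_1,x_1-x_2)}{-x_1+2x_2}.$$ The condition $\deg P_w=\ell(w)$ includes that $P_w\neq0$; in particular $P_{id}$ is a nonzero constant (normalized to $P_{id}=1$ in the paper's computation). *)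

theory Defs
  imports "HOL-Algebra.Generated_Groups" "HOL-Computational_Algebra.Polynomial"
begin

text \<open>
  A group with generators \<open>s, t\<close> satisfying \<open>s\<^sup>2 = t\<^sup>2 = (st)\<^sup>6 = 1\<close> is a quotient of
  \<open>\<langle>s, t | s\<^sup>2 = t\<^sup>2 = (st)\<^sup>6 = 1\<rangle>\<close>, which has 12 elements; so requiring order 12 says that \<open>W\<close>
  is the presented group itself, with \<open>s, t\<close> its distinguished generators.
\<close>

definition weyl_group_G2 :: "('w, 'b) monoid_scheme \<Rightarrow> 'w \<Rightarrow> 'w \<Rightarrow> bool" where
  "weyl_group_G2 W s t \<longleftrightarrow>
     group W \<and> s \<in> carrier W \<and> t \<in> carrier W \<and> generate W {s, t} = carrier W \<and>
     s [^]\<^bsub>W\<^esub> (2::nat) = \<one>\<^bsub>W\<^esub> \<and> t [^]\<^bsub>W\<^esub> (2::nat) = \<one>\<^bsub>W\<^esub> \<and> (s \<otimes>\<^bsub>W\<^esub> t) [^]\<^bsub>W\<^esub> (6::nat) = \<one>\<^bsub>W\<^esub> \<and>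
     Coset.order W = 12"

text \<open>
  Words in \<open>S\<close> only, without inverses: this is the usual word length when the elements of \<open>S\<close> are
  involutions.
\<close>

definition word_length :: "('w, 'b) monoid_scheme \<Rightarrow> 'w set \<Rightarrow> 'w \<Rightarrow> nat" where
  "word_length W S w =
     (LEAST n. \<exists>us. length us = n \<and> set us \<subseteq> S \<and> foldr (\<lambda>u v. u \<otimes>\<^bsub>W\<^esub> v) us \<one>\<^bsub>W\<^esub> = w)"

text \<open>
  \<open>\<real>[x\<^sub>1, x\<^sub>2]\<close> is taken as \<open>\<real>[x\<^sub>1][x\<^sub>2]\<close>: the outer variable is \<open>x\<^sub>2\<close>.
\<close>

type_synonym bipoly = "real poly poly"

definition X1 :: bipoly where "X1 = [:[:0, 1:]:]"

definition X2 :: bipoly where "X2 = [:0, 1:]"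

text \<open>The coefficient of \<open>x\<^sub>1\<^sup>i x\<^sub>2\<^sup>j\<close>.\<close>

definition bicoeff :: "bipoly \<Rightarrow> nat \<Rightarrow> nat \<Rightarrow> real" where
  "bicoeff f i j = coeff (coeff f j) i"

text \<open>The zero polynomial is homogeneous of every degree.\<close>

definition homogeneous :: "nat \<Rightarrow> bipoly \<Rightarrow> bool" where
  "homogeneous d f \<longleftrightarrow> (\<forall>i j. bicoeff f i j \<noteq> 0 \<longrightarrow> i + j = d)"

text \<open>The substitution \<open>f(a, b)\<close>.\<close>

definition bisubst :: "bipoly \<Rightarrow> bipoly \<Rightarrow> bipoly \<Rightarrow> bipoly" where
  "bisubst f a b = poly (map_poly (\<lambda>q. poly (map_poly (\<lambda>c. [:[:c:]:]) q) a) f) b"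

text \<open>
  Here \<open>div\<close> is division in the integral domain \<open>\<real>[x\<^sub>1][x\<^sub>2]\<close>; it is exact in both cases, as
  shown below.
\<close>

definition divdiff_s :: "bipoly \<Rightarrow> bipoly" where
  "divdiff_s f = (f - bisubst f X2 X1) div (X1 - X2)"

definition divdiff_t :: "bipoly \<Rightarrow> bipoly" where
  "divdiff_t f = (f - bisubst f X1 (X1 - X2)) div (- X1 + 2 * X2)"

lemma bisubst_0 [simp]: "bisubst 0 a b = 0"
  by (simp add: bisubst_def)

lemma bisubst_pCons:
  "bisubst (pCons q f) a b = poly (map_poly (\<lambda>c. [:[:c:]:]) q) a + b * bisubst f a b"
  by (simp add: bisubst_def map_poly_pCons)

lemma bisubst_X1_X2: "bisubst f X1 X2 = f"
proof (induction f)
  case (pCons q f)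
  have "poly (map_poly (\<lambda>c. [:[:c:]:]) q) X1 = [:q:]"
    by (induction q) (simp_all add: map_poly_pCons X1_def)
  with pCons show ?case by (simp add: bisubst_pCons X2_def)
qed simp

lemma dvd_mult_diff:
  fixes d :: "'a :: comm_ring_1"
  assumes "d dvd a - a'" "d dvd b - b'"
  shows "d dvd a * b - a' * b'"
proof -
  have "a * b - a' * b' = (a - a') * b + a' * (b - b')" by (simp add: algebra_simps)
  with assms show ?thesis by simp
qed

lemma dvd_bisubst_diff:
  assumes a: "d dvd a - a'" and b: "d dvd b - b'"
  shows "d dvd bisubst f a b - bisubst f a' b'"
proof (induction f)
  case (pCons q f)
  let ?h = "\<lambda>q a. poly (map_poly (\<lambda>c. [:[:c:]:]) q) a"
  have "d dvd ?h q a - ?h q a'"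
    by (induction q) (use a in \<open>simp_all add: map_poly_pCons dvd_mult_diff\<close>)
  moreover have "d dvd b * bisubst f a b - b' * bisubst f a' b'"
    using b pCons.IH by (rule dvd_mult_diff)
  ultimately have "d dvd (?h q a - ?h q a') + (b * bisubst f a b - b' * bisubst f a' b')"
    by (rule dvd_add)
  then show ?case by (simp add: bisubst_pCons algebra_simps)
qed simp

lemma divdiff_s_exact: "(X1 - X2) * divdiff_s f = f - bisubst f X2 X1"
proof -
  have "X1 - X2 dvd X2 - X1" by (metis dvd_minus_iff dvd_refl minus_diff_eq)
  then have "X1 - X2 dvd bisubst f X1 X2 - bisubst f X2 X1"
    by (intro dvd_bisubst_diff) auto
  then show ?thesis by (simp add: bisubst_X1_X2 divdiff_s_def)
qed

lemma divdiff_t_exact: "(- X1 + 2 * X2) * divdiff_t f = f - bisubst f X1 (X1 - X2)"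
proof -
  have "- X1 + 2 * X2 dvd bisubst f X1 X2 - bisubst f X1 (X1 - X2)"
    by (intro dvd_bisubst_diff) auto
  then show ?thesis by (simp add: bisubst_X1_X2 divdiff_t_def)
qed

end

theory Submission imports Defs begin

text \<open>
  Already the chain \<open>tsts, tst, ts\<close> of elements of lengths \<open>4, 3, 2\<close> rules out that no
  \<open>P\<^sub>w\<close> has coefficients of both signs. Write \<open>P\<^bsub>tsts\<^esub> = a x\<^sub>1\<^sup>4 + b x\<^sub>1\<^sup>3 x\<^sub>2 + c x\<^sub>1\<^sup>2 x\<^sub>2\<^sup>2 +
  d x\<^sub>1 x\<^sub>2\<^sup>3 + e x\<^sub>2\<^sup>4\<close>. As \<open>tstst\<close> has length \<open>5\<close>, this polynomial is killed by
  \<open>\<partial>\<^sub>t\<close>, which amounts to \<open>d = - 2 e\<close> and \<open>b + c = e\<close>. If no two coefficients have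
  opposite signs, the first equation forces \<open>d = e = 0\<close> and then the second forces
  \<open>b = c = 0\<close>; so \<open>P\<^bsub>tsts\<^esub> = a x\<^sub>1\<^sup>4\<close> with \<open>a \<noteq> 0\<close>. Descending twice,
  \<open>P\<^bsub>ts\<^esub> = \<partial>\<^sub>t \<partial>\<^sub>s (a x\<^sub>1\<^sup>4) = a (3 x\<^sub>1\<^sup>2 - x\<^sub>1 x\<^sub>2 + x\<^sub>2\<^sup>2)\<close>,
  which does have coefficients of both signs.

  What remains is that these words are reduced (\<open>word_length_alt\<close>). Cancelling equal neighbours
  turns every word into an alternating word that is no longer, and the relation \<open>(st)\<^sup>n = 1\<close> leaves
  at most \<open>2 n\<close> values of alternating words. If the group has exactly \<open>2 n\<close> elements, these values
  are distinct, so that no alternating word of length less than \<open>n\<close> has a shorter expression.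
\<close>

section \<open>Lengths in dihedral groups\<close>

locale dihedral_group = group W for W (structure) +
  fixes s t and n :: nat
  assumes s_closed [simp]: "s \<in> carrier W"
    and t_closed [simp]: "t \<in> carrier W"
    and generated: "generate W {s, t} = carrier W"
    and s_square: "s \<otimes> s = \<one>"
    and t_square: "t \<otimes> t = \<one>"
    and st_pow: "(s \<otimes> t) [^] n = \<one>"
    and order: "Coset.order W = 2 * n"
    and n_pos: "n > 0"
begin

definition gen :: "bool \<Rightarrow> 'a" where
  "gen x = (if x then s else t)"

text \<open>
  Naming the letters by truth values makes negation the passage to the other letter;
  \<open>alt x k\<close> is the value of the alternating word of length \<open>k\<close> that starts with \<open>gen x\<close>.
\<close>

primrec alt :: "bool \<Rightarrow> nat \<Rightarrow> 'a" where
  "alt x 0 = \<one>"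
| "alt x (Suc k) = gen x \<otimes> alt (\<not> x) k"

lemma gen_closed [simp]: "gen x \<in> carrier W"
  by (simp add: gen_def)

lemma alt_closed [simp]: "alt x k \<in> carrier W"
  by (induction k arbitrary: x) simp_all

lemma gen_gen [simp]: "gen x \<otimes> (gen x \<otimes> u) = u" if "u \<in> carrier W"
  using that s_square t_square by (simp add: gen_def m_assoc [symmetric])

lemma inv_gen: "inv (gen x) = gen x"
  using s_square t_square by (simp add: gen_def inv_equality)

lemma letter_eq_gen: "h \<in> {s, t} \<Longrightarrow> \<exists>x. h = gen x"
  by (auto simp: gen_def intro: exI [of _ True] exI [of _ False])

text \<open>Left multiplication by a letter lengthens an alternating word or cancels its first letter.\<close>

lemma gen_mult_alt: "\<exists>y j. gen x \<otimes> alt z k = alt y j \<and> j \<le> Suc k"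
proof (cases "k = 0 \<or> z \<noteq> x")
  case True
  then have "gen x \<otimes> alt z k = alt x (Suc k)" by auto
  then show ?thesis by blast
next
  case False
  then obtain k' where "k = Suc k'" "z = x" by (cases k) auto
  then have "gen x \<otimes> alt z k = alt (\<not> x) k'" by simp
  with \<open>k = Suc k'\<close> show ?thesis by (meson le_SucI lessI less_imp_le)
qed

lemma word_eq_alt:
  assumes "set us \<subseteq> {s, t}"
  shows "\<exists>x k. foldr (\<otimes>) us \<one> = alt x k \<and> k \<le> length us"
  using assms
proof (induction us)
  case Nil
  show ?case by (auto intro: exI [of _ 0])
next
  case (Cons u us)
  then obtain z k where zk: "foldr (\<otimes>) us \<one> = alt z k" "k \<le> length us" by auto
  obtain x where "u = gen x" using Cons.prems letter_eq_gen [of u] by auto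
  with zk gen_mult_alt [of x z k] show ?case by fastforce
qed

lemma alt_eq_word:
  "\<exists>us. length us = k \<and> set us \<subseteq> {s, t} \<and> foldr (\<otimes>) us \<one> = alt x k"
proof (induction k arbitrary: x)
  case (Suc k)
  obtain us where "length us = k" "set us \<subseteq> {s, t}" "foldr (\<otimes>) us \<one> = alt (\<not> x) k"
    using Suc by blast
  then show ?case by (intro exI [of _ "gen x # us"]) (auto simp: gen_def)
qed simp

lemma alt_double: "alt True (2 * k) = (s \<otimes> t) [^] k"
proof (induction k)
  case (Suc k)
  have "alt True (2 * Suc k) = (s \<otimes> t) \<otimes> (s \<otimes> t) [^] k"
    using Suc by (simp add: gen_def m_assoc)
  then show ?case using nat_pow_Suc2 [of "s \<otimes> t" k] by simp
qed simp

text \<open>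
  Multiplying an equation between alternating words with different first letters by the first
  letter of the left one moves that letter to the right-hand side.
\<close>

lemma alt_shift: "alt x (k + i) = alt (\<not> x) j \<Longrightarrow> \<exists>y. alt y k = alt (\<not> y) (j + i)"
proof (induction i arbitrary: x j)
  case (Suc i)
  have "alt (\<not> x) (k + i) = gen x \<otimes> alt x (k + Suc i)" by simp
  also have "\<dots> = alt x (Suc j)" using Suc.prems by simp
  finally show ?case using Suc.IH [of "\<not> x" "Suc j"] by simp
qed auto

text \<open>
  The braid relation: \<open>(st)\<^sup>n = 1\<close> is an equation between alternating words of lengths \<open>2 n\<close>
  and \<open>0\<close>, in which \<open>n\<close> letters can be moved to the other side.
\<close>

lemma alt_braid: "alt x n = alt y n"
proof -
  have "alt True (n + n) = alt (\<not> True) 0"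
    using alt_double [of n] st_pow by (simp add: mult_2)
  then obtain z where "alt z n = alt (\<not> z) n" using alt_shift [of True n n 0] by auto
  then show ?thesis by (cases x; cases y; cases z) auto
qed

text \<open>
  The two empty words and, by the braid relation, the two alternating words of length \<open>n\<close> have the
  same value; of each of these pairs only the member with first component \<open>True\<close> is kept.
\<close>

definition indices :: "(bool \<times> nat) set" where
  "indices = Pair True ` {..n} \<union> Pair False ` {1..<n}"

lemma card_indices: "card indices = 2 * n"
proof -
  have "card indices = card (Pair True ` {..n}) + card (Pair False ` {1..<n})"
    unfolding indices_def by (rule card_Un_disjoint) auto
  also have "\<dots> = Suc n + (n - 1)" by (simp add: card_image inj_on_def)
  finally show ?thesis using n_pos by simp
qed

lemma alt_in_image:
  assumes "k \<le> n"
  shows "alt x k \<in> (\<lambda>(x, k). alt x k) ` indices"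
proof -
  obtain y where "(y, k) \<in> indices" "alt x k = alt y k"
  proof (cases "k = 0 \<or> k = n \<or> x")
    case True
    then have "alt x k = alt True k" using alt_braid by (elim disjE) simp_all
    moreover have "(True, k) \<in> indices" using assms by (simp add: indices_def)
    ultimately show ?thesis using that by blast
  next
    case False
    then have "(x, k) \<in> indices" using assms by (simp add: indices_def image_iff)
    then show ?thesis using that by blast
  qed
  then show ?thesis by (intro image_eqI [of _ _ "(y, k)"]) simp_all
qed

lemma gen_mult_image:
  assumes "u \<in> (\<lambda>(x, k). alt x k) ` indices"
  shows "gen x \<otimes> u \<in> (\<lambda>(x, k). alt x k) ` indices"
proof -
  obtain z k where u: "u = alt z k" "k \<le> n" using assms by (auto simp: indices_def)
  show ?thesis
  proof (cases "k = n")
    case True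
    \<comment> \<open>At maximal length the braid relation lets the word start with the letter to be cancelled.\<close>
    have "u = alt z n" using u True by simp
    also have "\<dots> = alt x (Suc (n - 1))" using alt_braid [of z x] n_pos by (simp del: alt.simps)
    finally have "gen x \<otimes> u = alt (\<not> x) (n - 1)" by simp
    then show ?thesis using alt_in_image [of "n - 1" "\<not> x"] by (simp only:)
  next
    case False
    obtain y j where yj: "gen x \<otimes> u = alt y j" "j \<le> Suc k"
      using gen_mult_alt [of x z k] u(1) by blast
    have "j \<le> n" using yj u False by linarith
    then show ?thesis unfolding yj(1) by (rule alt_in_image)
  qed
qed

text \<open>
  The set of values of the alternating words of length at most \<open>n\<close> contains \<open>\<one>\<close> and is closed
  under left multiplication by the letters, so it exhausts the group.
\<close>

lemma carrier_eq_alt: "carrier W = (\<lambda>(x, k). alt x k) ` indices" (is "_ = ?A")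
proof (rule subset_antisym)
  have A_closed: "?A \<subseteq> carrier W" by (simp add: image_subset_iff split_beta)
  show "?A \<subseteq> carrier W" by (rule A_closed)
  show "carrier W \<subseteq> ?A"
  proof (rule subsetI)
    fix w assume w: "w \<in> carrier W"
    then have "w \<in> generate W {s, t}" by (simp add: generated)
    \<comment> \<open>Products in \<open>generate\<close> have arbitrary factors, hence an invariant that composes: mapping
      the image to itself by left multiplication.\<close>
    then have "\<forall>u \<in> ?A. w \<otimes> u \<in> ?A"
    proof (induction w rule: generate.induct)
      case one
      show ?case
      proof
        fix u assume u: "u \<in> ?A"
        then have "u \<in> carrier W" using A_closed by (rule rev_subsetD)
        then show "\<one> \<otimes> u \<in> ?A" using u by (simp only: l_one)
      qed
    next
      case (incl h)
      then obtain x where h: "h = gen x" using letter_eq_gen by blast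
      show ?case unfolding h by (intro ballI gen_mult_image)
    next
      case (inv h)
      then obtain x where h: "h = gen x" using letter_eq_gen by blast
      show ?case unfolding h inv_gen by (intro ballI gen_mult_image)
    next
      case (eng h1 h2)
      have h: "h1 \<in> carrier W" "h2 \<in> carrier W" using eng.hyps generated by blast+
      show ?case
      proof
        fix u assume u: "u \<in> ?A"
        then have "u \<in> carrier W" using A_closed by (rule rev_subsetD)
        then have "h1 \<otimes> h2 \<otimes> u = h1 \<otimes> (h2 \<otimes> u)" using h by (simp only: m_assoc)
        moreover have "h1 \<otimes> (h2 \<otimes> u) \<in> ?A" using eng.IH u by blast
        ultimately show "h1 \<otimes> h2 \<otimes> u \<in> ?A" by (simp only:)
      qed
    qed
    then have "w \<otimes> alt True 0 \<in> ?A"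
      using alt_in_image [of 0 True] by blast
    then show "w \<in> ?A" using w by simp
  qed
qed

text \<open>
  The order of the group enters here: \<open>2 n\<close> indices are mapped onto \<open>2 n\<close> elements.
\<close>

lemma inj_on_alt: "inj_on (\<lambda>(x, k). alt x k) indices"
proof (rule eq_card_imp_inj_on)
  show "finite indices" by (simp add: indices_def)
  show "card ((\<lambda>(x, k). alt x k) ` indices) = card indices"
    using carrier_eq_alt card_indices order by (simp add: Coset.order_def)
qed

lemma alt_neq:
  assumes "j < k" "k < n"
  shows "alt y j \<noteq> alt x k"
proof
  assume eq: "alt y j = alt x k"
  \<comment> \<open>Only \<open>j\<close> can be \<open>0\<close>, and the empty word is indexed by \<open>True\<close> alone.\<close>
  define y' where "y' = (j = 0 \<or> y)"
  have "alt y' j = alt y j" by (cases "j = 0") (simp_all add: y'_def)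
  then have "alt y' j = alt x k" unfolding eq .
  moreover have "(y', j) \<in> indices"
    using assms by (cases y') (simp_all add: indices_def image_iff y'_def)
  moreover have "(x, k) \<in> indices"
    using assms by (cases x) (simp_all add: indices_def image_iff)
  ultimately have "(y', j) = (x, k)"
    using inj_onD [OF inj_on_alt, of "(y', j)" "(x, k)"] by simp
  with assms show False by simp
qed

lemma word_length_alt:
  assumes "k < n"
  shows "word_length W {s, t} (alt x k) = k"
  unfolding word_length_def
proof (rule Least_equality)
  show "\<exists>us. length us = k \<and> set us \<subseteq> {s, t} \<and> foldr (\<otimes>) us \<one> = alt x k"
    by (rule alt_eq_word)
next
  fix m
  assume "\<exists>us. length us = m \<and> set us \<subseteq> {s, t} \<and> foldr (\<otimes>) us \<one> = alt x k"
  then obtain us where "length us = m" "set us \<subseteq> {s, t}" "foldr (\<otimes>) us \<one> = alt x k" by blast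
  then obtain y j where "alt y j = alt x k" "j \<le> m" using word_eq_alt [of us] by auto
  then have "\<not> j < k" using alt_neq [of j k y x] assms by blast
  with \<open>j \<le> m\<close> show "k \<le> m" by linarith
qed

end

lemma weyl_group_G2_dihedral:
  assumes "weyl_group_G2 W s t"
  shows "dihedral_group W s t 6"
proof -
  interpret group W using assms by (simp add: weyl_group_G2_def)
  show ?thesis
    using assms by unfold_locales (auto simp: weyl_group_G2_def numeral_2_eq_2)
qed

section \<open>Binary forms of degree four\<close>

text \<open>
  In the nested coefficient lists, the entry at position \<open>j\<close> is the coefficient of \<open>x\<^sub>2\<^sup>j\<close>, which
  is a multiple of \<open>x\<^sub>1\<close> to the power \<open>4 - j\<close>.
\<close>

lemma homogeneous_4_expand:
  assumes "homogeneous 4 f"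
  shows "f = [:[:0, 0, 0, 0, bicoeff f 4 0:], [:0, 0, 0, bicoeff f 3 1:],
    [:0, 0, bicoeff f 2 2:], [:0, bicoeff f 1 3:], [:bicoeff f 0 4:]:]"
    (is "f = ?g")
proof (intro poly_eqI)
  fix j i
  show "coeff (coeff f j) i = coeff (coeff ?g j) i"
  proof (cases "i + j = 4")
    case True
    then have "(i, j) \<in> {(4, 0), (3, 1), (2, 2), (1, 3), (0, 4)}" by auto
    then show ?thesis by (auto simp: bicoeff_def numeral_eq_Suc)
  next
    case False
    then have "coeff (coeff f j) i = 0" using assms by (auto simp: homogeneous_def bicoeff_def)
    with False show ?thesis
      by (auto simp: coeff_pCons numeral_eq_Suc split: nat.splits)
  qed
qed

text \<open>
  The divisions defining the operators are exact, so a quotient is found by guessing it and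
  multiplying out.
\<close>

lemma divdiff_s_eqI:
  assumes "(X1 - X2) * g = f - bisubst f X2 X1"
  shows "divdiff_s f = g"
proof -
  have "X1 - X2 \<noteq> 0" by (simp add: X1_def X2_def)
  then show ?thesis using assms divdiff_s_exact [of f] by (metis mult_left_cancel)
qed

lemma divdiff_t_eqI:
  assumes "(- X1 + 2 * X2) * g = f - bisubst f X1 (X1 - X2)"
  shows "divdiff_t f = g"
proof -
  have "- X1 + 2 * X2 \<noteq> 0" by (simp add: X1_def X2_def numeral_poly)
  then show ?thesis using assms divdiff_t_exact [of f] by (metis mult_left_cancel)
qed

lemma divdiff_t_quartic:
  "divdiff_t [:[:0, 0, 0, 0, a:], [:0, 0, 0, b:], [:0, 0, c:], [:0, d:], [:e:]:] =
    [:[:0, 0, 0, b + c + d + e:], [:0, 0, - (d + 2 * e):], [:0, d + 2 * e:]:]"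
  by (rule divdiff_t_eqI)
    (simp add: bisubst_pCons map_poly_pCons X1_def X2_def numeral_poly algebra_simps)

lemma divdiff_s_X1_pow_4:
  "divdiff_s [:[:0, 0, 0, 0, a:]:] = [:[:0, 0, 0, a:], [:0, 0, a:], [:0, a:], [:a:]:]"
  by (rule divdiff_s_eqI)
    (simp add: bisubst_pCons map_poly_pCons X1_def X2_def numeral_poly algebra_simps)

lemma divdiff_t_cubic:
  "divdiff_t [:[:0, 0, 0, a:], [:0, 0, a:], [:0, a:], [:a:]:] =
    [:[:0, 0, 3 * a:], [:0, - a:], [:a:]:]"
  by (rule divdiff_t_eqI)
    (simp add: bisubst_pCons map_poly_pCons X1_def X2_def numeral_poly algebra_simps)

definition mixed_signs :: "bipoly \<Rightarrow> bool" where
  "mixed_signs f \<longleftrightarrow> (\<exists>i j. bicoeff f i j > 0) \<and> (\<exists>i j. bicoeff f i j < 0)"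

lemma not_mixed_signsD:
  "\<not> mixed_signs f \<Longrightarrow> \<not> (bicoeff f i j > 0 \<and> bicoeff f k l < 0)"
  by (auto simp: mixed_signs_def)

text \<open>
  The kernel of \<open>\<partial>\<^sub>t\<close> in degree four is spanned by \<open>x\<^sub>1\<^sup>4\<close>, \<open>x\<^sub>1\<^sup>2 x\<^sub>2 (x\<^sub>1 - x\<^sub>2)\<close> and
  \<open>x\<^sub>2\<^sup>2 (x\<^sub>1 - x\<^sub>2)\<^sup>2\<close>, and only multiples of the first avoid opposite signs.
\<close>

lemma quartic_divdiff_t_eq_0:
  assumes hom: "homogeneous 4 f" and "divdiff_t f = 0" and unmixed: "\<not> mixed_signs f"
  shows "f = [:[:0, 0, 0, 0, bicoeff f 4 0:]:]"
proof -
  have "divdiff_t [:[:0, 0, 0, 0, bicoeff f 4 0:], [:0, 0, 0, bicoeff f 3 1:],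
    [:0, 0, bicoeff f 2 2:], [:0, bicoeff f 1 3:], [:bicoeff f 0 4:]:] = 0"
    using \<open>divdiff_t f = 0\<close> homogeneous_4_expand [OF hom] by simp
  then have rel: "bicoeff f 1 3 + 2 * bicoeff f 0 4 = 0"
    "bicoeff f 3 1 + bicoeff f 2 2 + bicoeff f 1 3 + bicoeff f 0 4 = 0"
    unfolding divdiff_t_quartic by simp_all
  have "bicoeff f 0 4 = 0" "bicoeff f 1 3 = 0"
    using rel(1) not_mixed_signsD [OF unmixed, of 0 4 1 3]
      not_mixed_signsD [OF unmixed, of 1 3 0 4] by linarith+
  moreover from this have "bicoeff f 3 1 = 0" "bicoeff f 2 2 = 0"
    using rel(2) not_mixed_signsD [OF unmixed, of 3 1 2 2]
      not_mixed_signsD [OF unmixed, of 2 2 3 1] by linarith+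
  ultimately show ?thesis using homogeneous_4_expand [OF hom] by simp
qed

text \<open>
  If the signs of \<open>f\<close> agree, then \<open>f = a x\<^sub>1\<^sup>4\<close> and
  \<open>\<partial>\<^sub>t \<partial>\<^sub>s f = a (3 x\<^sub>1\<^sup>2 - x\<^sub>1 x\<^sub>2 + x\<^sub>2\<^sup>2)\<close>, where \<open>3 a\<close> and \<open>- a\<close> have opposite signs.
\<close>

lemma quartic_mixed_signs:
  assumes "homogeneous 4 f" "f \<noteq> 0" "divdiff_t f = 0"
  shows "mixed_signs (divdiff_t (divdiff_s f)) \<or> mixed_signs f"
proof (rule disjCI)
  assume "\<not> mixed_signs f"
  then obtain a where f: "f = [:[:0, 0, 0, 0, a:]:]"
    using assms quartic_divdiff_t_eq_0 by blast
  with \<open>f \<noteq> 0\<close> have "a \<noteq> 0" by auto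
  let ?g = "divdiff_t (divdiff_s f)"
  have "?g = [:[:0, 0, 3 * a:], [:0, - a:], [:a:]:]"
    unfolding f divdiff_s_X1_pow_4 divdiff_t_cubic ..
  then have "bicoeff ?g 2 0 = 3 * a" "bicoeff ?g 1 1 = - a"
    by (simp_all add: bicoeff_def numeral_eq_Suc)
  moreover have "3 * a > 0 \<and> - a < 0 \<or> - a > 0 \<and> 3 * a < 0" using \<open>a \<noteq> 0\<close> by linarith
  ultimately show "mixed_signs ?g" unfolding mixed_signs_def by metis
qed

section \<open>Opposite signs in type \<open>G\<^sub>2\<close>\<close>

theorem proposition7p4:
  fixes W :: "('w, 'b) monoid_scheme" (structure)
    and s t :: 'w
    and P :: "'w \<Rightarrow> bipoly"
  assumes W: "weyl_group_G2 W s t"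
    and deg: "\<And>w. w \<in> carrier W \<Longrightarrow> homogeneous (word_length W {s, t} w) (P w) \<and> P w \<noteq> 0"
    and s_desc: "\<And>w. w \<in> carrier W \<Longrightarrow> word_length W {s, t} (w \<otimes> s) < word_length W {s, t} w
      \<Longrightarrow> divdiff_s (P w) = P (w \<otimes> s)"
    and s_asc: "\<And>w. w \<in> carrier W \<Longrightarrow> word_length W {s, t} (w \<otimes> s) > word_length W {s, t} w
      \<Longrightarrow> divdiff_s (P w) = 0"
    and t_desc: "\<And>w. w \<in> carrier W \<Longrightarrow> word_length W {s, t} (w \<otimes> t) < word_length W {s, t} w
      \<Longrightarrow> divdiff_t (P w) = P (w \<otimes> t)"
    and t_asc: "\<And>w. w \<in> carrier W \<Longrightarrow> word_length W {s, t} (w \<otimes> t) > word_length W {s, t} w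
      \<Longrightarrow> divdiff_t (P w) = 0"
  shows "\<exists>w \<in> carrier W. (\<exists>i j. bicoeff (P w) i j > 0) \<and> (\<exists>i j. bicoeff (P w) i j < 0)"
proof -
  interpret dihedral_group W s t 6 using W by (rule weyl_group_G2_dihedral)
  have len: "word_length W {s, t} (alt False k) = k" if "k \<le> 5" for k
    using that by (intro word_length_alt) simp
  have alt_unfold: "alt False 2 = t \<otimes> s" "alt False 3 = t \<otimes> (s \<otimes> t)"
    "alt False 4 = t \<otimes> (s \<otimes> (t \<otimes> s))" "alt False 5 = t \<otimes> (s \<otimes> (t \<otimes> (s \<otimes> t)))"
    by (simp_all add: gen_def numeral_eq_Suc)
  have right: "alt False 4 \<otimes> t = alt False 5" "alt False 4 \<otimes> s = alt False 3"
    "alt False 3 \<otimes> t = alt False 2"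
    by (simp_all add: alt_unfold m_assoc s_square t_square)
  let ?f = "P (alt False 4)"
  have "homogeneous 4 ?f" "?f \<noteq> 0"
    using deg [of "alt False 4"] len [of 4] by simp_all
  moreover have "divdiff_t ?f = 0"
    using t_asc [of "alt False 4"] right len [of 4] len [of 5] by simp
  moreover have "divdiff_t (divdiff_s ?f) = P (alt False 2)"
    using s_desc [of "alt False 4"] t_desc [of "alt False 3"] right
      len [of 4] len [of 3] len [of 2] by simp
  ultimately have "mixed_signs (P (alt False 2)) \<or> mixed_signs ?f"
    using quartic_mixed_signs [of ?f] by simp
  then show ?thesis unfolding mixed_signs_def by (meson alt_closed)
qed

end
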